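(* Let $n\ge 2$. The following decomposition of $L(\mathfrak{S}_n)$ as a direct sum of linear subspaces holds: $$L(\mathfrak{S}_n)=V^0\oplus\bigoplus_{A\in\mathcal{P}([n])}W_A .$$ In addition, $\dim W_A=d_{|A|}$ and $\phi_n(H_A)=W_A$ for all $A\in\mathcal{P}([n])$.
   Context: Let $[n]=\{1,\dots,n\}$. For a finite set $E$, $\mathcal{P}(E)$ denotes the set of all subsets of $E$ with at least two elements, and $L(E)$ the real vector space of functions $E\to\mathbb{R}$; an element of $E$ is identified with its Dirac function in $L(E)$, and $\mathbf{1}_S$ is the indicator function of $S\subset E$. An injective word over $[n]$ is a finite sequence $\omega=\omega_1\cdots\omega_k$ of distinct elements of $[n]$ ($0\le k\le n$, the empty word $\overline{0}$ being allowed); its content is $c(\omega)=\{\omega_1,\dots,\omega_k\}$. $\Gamma_n$ is the set of all injective words over $[n]$, and $\Gamma(A)=\{\omega\in\Gamma_n : c(\omega)=A\}$ for $A\subset[n]$; $L(\Gamma(A))$ is viewed as a subspace of $L(\Gamma_n)$. The symmetric group $\mathfrak{S}_n$ is identified, as a set, with $\Gamma([n])$ (a permutation $\sigma$ corresponds to the word $\sigma^{-1}(1)\cdots\sigma^{-1}(n)$). For $a\in[n]$, the deletion operator $\varrho_a:L(\Gamma_n)\to L(\Gamma_n)$ is the linear map sending the Dirac function of a word $\pi$ to that of the word obtained from $\pi$ by deleting the letter $a$ if $a\in c(\pi)$, and to that of $\pi$ itself otherwise. For $A\in\mathcal{P}([n])$, $$H_A=\{x\in L(\Gamma(A)) : \varrho_a(x)=0\text{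 for all }a\in A\}.$$ For a word $\pi\in\Gamma_n$, $\mathfrak{S}_n[\pi]$ is the set of words $\sigma\in\Gamma([n])$ containing $\pi$ as a contiguous block, i.e. of the form $\sigma=\omega_1\pi\omega_2$ with $\omega_1,\omega_2\in\Gamma_n$. The linear operator $\phi_n:L(\Gamma_n)\to L(\mathfrak{S}_n)$ is defined on Dirac functions by $\phi_n\pi=\mathbf{1}_{\mathfrak{S}_n[\pi]}$, and $W_A:=\phi_n(H_A)\subset L(\mathfrak{S}_n)$ for $A\in\mathcal{P}([n])$. $V^0$ is the one-dimensional space of constant functions on $\mathfrak{S}_n$. $d_k$ is the number of derangements (fixed-point free permutations) of $\{1,\dots,k\}$. *)

theory Defs
  imports "HOL-Analysis.Analysis" "HOL-Library.Function_Algebras"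
begin

instantiation "fun" :: (type, real_vector) real_vector
begin

definition scaleR_fun :: "real \<Rightarrow> ('a \<Rightarrow> 'b) \<Rightarrow> 'a \<Rightarrow> 'b"
  where "scaleR_fun c f = (\<lambda>x. c *\<^sub>R f x)"

instance
  by standard (auto simp: scaleR_fun_def fun_eq_iff scaleR_add_right scaleR_add_left)

end

text \<open>
  Functions on a set \<open>E\<close> are extended by zero outside \<open>E\<close>, so that \<open>E \<subseteq> F\<close> makes
  \<open>Lfun E\<close> literally a subspace of \<open>Lfun F\<close>. The Dirac function of \<open>e\<close> is \<open>indicator {e}\<close>.
\<close>

definition Lfun :: "'a set \<Rightarrow> ('a \<Rightarrow> real) set"
  where "Lfun E = {x. \<forall>e. e \<notin> E \<longrightarrow> x e = 0}"

text \<open>The linear map on \<open>Lfun E\<close> (for finite \<open>E\<close>) with \<open>indicator {e} \<mapsto> f e\<close> for \<open>e \<in> E\<close>.\<close>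

definition linear_extension :: "'a set \<Rightarrow> ('a \<Rightarrow> 'v::real_vector) \<Rightarrow> ('a \<Rightarrow> real) \<Rightarrow> 'v"
  where "linear_extension E f x = (\<Sum>e\<in>E. x e *\<^sub>R f e)"

definition subsets_ge2 :: "'a set \<Rightarrow> 'a set set"
  where "subsets_ge2 E = {A. A \<subseteq> E \<and> 2 \<le> card A}"

definition inj_words :: "nat \<Rightarrow> nat list set"
  where "inj_words n = {w. distinct w \<and> set w \<subseteq> {1..n}}"

definition words_on :: "nat set \<Rightarrow> nat list set"
  where "words_on A = {w. distinct w \<and> set w = A}"

text \<open>
  A permutation \<open>\<sigma>\<close> of \<open>{1..n}\<close> is represented by the word
  \<open>\<sigma>\<^sup>-\<^sup>1(1) \<dots> \<sigma>\<^sup>-\<^sup>1(n)\<close>; see \<open>bij_betw_permutation_words\<close> below.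
\<close>

abbreviation perm_words :: "nat \<Rightarrow> nat list set"
  where "perm_words n \<equiv> words_on {1..n}"

lemma finite_inj_words: "finite (inj_words n)"
proof (rule finite_subset)
  show "inj_words n \<subseteq> {w. set w \<subseteq> {1..n} \<and> length w \<le> n}"
  proof
    fix w assume "w \<in> inj_words n"
    then have w: "distinct w" "set w \<subseteq> {1..n}" by (auto simp: inj_words_def)
    have "length w \<le> n"
      using card_mono[OF _ w(2)] distinct_card[OF w(1)] by simp
    then show "w \<in> {w. set w \<subseteq> {1..n} \<and> length w \<le> n}" using w by simp
  qed
  show "finite {w. set w \<subseteq> {1..n} \<and> length w \<le> n}"
    by (rule finite_lists_length_le) simp
qed

lemma bij_betw_permutation_words:
  "bij_betw (\<lambda>\<sigma>. map (inv \<sigma>) [1..<Suc n]) {\<sigma>. \<sigma> permutes {1..n}} (perm_words n)"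
proof (rule bij_betw_imageI)
  show "inj_on (\<lambda>\<sigma>. map (inv \<sigma>) [1..<Suc n]) {\<sigma>. \<sigma> permutes {1..n}}"
  proof (rule inj_onI)
    fix p q :: "nat \<Rightarrow> nat"
    assume "p \<in> {\<sigma>. \<sigma> permutes {1..n}}" "q \<in> {\<sigma>. \<sigma> permutes {1..n}}"
    then have pq: "p permutes {1..n}" "q permutes {1..n}" by auto
    assume "map (inv p) [1..<Suc n] = map (inv q) [1..<Suc n]"
    then have eq: "inv p i = inv q i" if "i \<in> {1..n}" for i
      using that by (auto simp del: upt_Suc)
    have "inv p = inv q"
    proof
      fix i
      show "inv p i = inv q i"
        using eq[of i] permutes_not_in[OF permutes_inv[OF pq(1)], of i]
          permutes_not_in[OF permutes_inv[OF pq(2)], of i]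
        by (cases "i \<in> {1..n}") simp_all
    qed
    then have "inv (inv p) = inv (inv q)" by (rule arg_cong)
    then show "p = q"
      by (simp only: permutes_inv_inv[OF pq(1)] permutes_inv_inv[OF pq(2)])
  qed
  show "(\<lambda>\<sigma>. map (inv \<sigma>) [1..<Suc n]) ` {\<sigma>. \<sigma> permutes {1..n}} = perm_words n" (is "?L = _")
  proof (intro equalityI subsetI)
    fix w assume "w \<in> ?L"
    then obtain p where p: "p permutes {1..n}" and w: "w = map (inv p) [1..<Suc n]" by auto
    have ip: "inv p permutes {1..n}" using p by (rule permutes_inv)
    have "set w = inv p ` {1..n}"
      by (simp add: w atLeastLessThanSuc_atLeastAtMost del: upt_Suc)
    also have "\<dots> = {1..n}" using ip by (rule permutes_image)
    finally have "set w = {1..n}" .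
    moreover have "distinct w"
      using permutes_inj_on[OF ip] by (simp add: w distinct_map del: upt_Suc)
    ultimately show "w \<in> perm_words n" by (simp add: words_on_def)
  next
    fix w assume "w \<in> perm_words n"
    then have d: "distinct w" and s: "set w = {1..n}" by (auto simp: words_on_def)
    have len: "length w = n" using distinct_card[OF d] s by simp
    define q where "q i = (if i \<in> {1..n} then w ! (i - 1) else i)" for i
    have "bij_betw q {1..n} {1..n}"
    proof (rule bij_betw_imageI)
      show "inj_on q {1..n}"
        using d len by (auto simp: inj_on_def q_def nth_eq_iff_index_eq)
      have "q ` {1..n} = (\<lambda>i. w ! (i - 1)) ` {1..n}" by (auto simp: q_def)
      also have "\<dots> = (\<lambda>i. w ! i) ` ((\<lambda>i. i - 1) ` {1..n})" by (simp add: image_image)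
      also have "(\<lambda>i. i - 1) ` {1..n} = {..<n}"
      proof (intro equalityI subsetI)
        fix j assume "j \<in> {..<n}"
        then show "j \<in> (\<lambda>i. i - 1) ` {1..n}"
          by (intro image_eqI[where x = "Suc j"]) auto
      qed auto
      also have "(\<lambda>i. w ! i) ` {..<n} = set w" using len by (auto simp: set_conv_nth)
      finally show "q ` {1..n} = {1..n}" using s by simp
    qed
    then have q: "q permutes {1..n}"
      by (rule bij_imp_permutes) (auto simp: q_def)
    have "map (inv (inv q)) [1..<Suc n] = w"
      unfolding permutes_inv_inv[OF q]
      by (rule nth_equalityI) (simp_all add: len q_def del: upt_Suc)
    then show "w \<in> ?L"
      using permutes_inv[OF q] by (intro image_eqI[where x = "inv q"]) simp_all
  qed
qed

definition deletion :: "nat \<Rightarrow> nat \<Rightarrow> (nat list \<Rightarrow> real) \<Rightarrow> nat list \<Rightarrow> real"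
  where "deletion n a = linear_extension (inj_words n) (\<lambda>\<pi>. indicator {removeAll a \<pi>})"

definition H_space :: "nat \<Rightarrow> nat set \<Rightarrow> (nat list \<Rightarrow> real) set"
  where "H_space n A = {x \<in> Lfun (words_on A). \<forall>a\<in>A. deletion n a x = 0}"

definition perm_words_containing :: "nat \<Rightarrow> nat list \<Rightarrow> nat list set"
  where "perm_words_containing n \<pi> =
    {\<sigma> \<in> perm_words n. \<exists>\<omega>\<^sub>1\<in>inj_words n. \<exists>\<omega>\<^sub>2\<in>inj_words n. \<sigma> = \<omega>\<^sub>1 @ \<pi> @ \<omega>\<^sub>2}"

definition phi :: "nat \<Rightarrow> (nat list \<Rightarrow> real) \<Rightarrow> nat list \<Rightarrow> real"
  where "phi n = linear_extension (inj_words n) (\<lambda>\<pi>. indicator (perm_words_containing n \<pi>))"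

definition W_space :: "nat \<Rightarrow> nat set \<Rightarrow> (nat list \<Rightarrow> real) set"
  where "W_space n A = phi n ` H_space n A"

definition V0 :: "nat \<Rightarrow> (nat list \<Rightarrow> real) set"
  where "V0 n = {x \<in> Lfun (perm_words n). \<exists>c. \<forall>\<sigma>\<in>perm_words n. x \<sigma> = c}"

definition derangements :: "nat \<Rightarrow> (nat \<Rightarrow> nat) set"
  where "derangements k = {p. p permutes {1..k} \<and> (\<forall>i\<in>{1..k}. p i \<noteq> i)}"

text \<open>
  Internal direct sum of a finite family: every element of \<open>V\<close> is in exactly one way a sum of
  one element from each \<open>U i\<close>, and all such sums lie in \<open>V\<close>.
\<close>

definition internal_direct_sum :: "'i set \<Rightarrow> ('i \<Rightarrow> 'v::real_vector set) \<Rightarrow> 'v set \<Rightarrow> bool"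
  where "internal_direct_sum I U V \<longleftrightarrow>
    finite I \<and> (\<forall>i\<in>I. subspace (U i)) \<and> bij_betw (\<lambda>u. \<Sum>i\<in>I. u i) (Pi\<^sub>E I U) V"

end

theory Submission
  imports Defs "HOL-Combinatorics.Multiset_Permutations"
begin

text \<open>
  The idea is to look at a function \<open>f\<close> on permutations through its marginals \<open>marginal n A f\<close>,
  in which every permutation \<open>\<sigma>\<close> is replaced by the word induced by \<open>\<sigma>\<close> on \<open>A\<close>. Deleting a
  letter \<open>a\<close> from the marginal on \<open>A\<close> gives the marginal on \<open>A - {a}\<close>. Hence, if the marginals
  of \<open>f\<close> on all proper subsets of \<open>A\<close> vanish, the marginal on \<open>A\<close> lies in \<open>H_space n A\<close>.

  Marginals interact with \<open>phi n\<close> in a triangular way. If \<open>x\<close> lives on words with content \<open>A\<close>,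
  then every \<open>\<sigma>\<close> that contains \<open>\<pi>\<close> as a block induces \<open>\<pi>\<close> on \<open>A\<close>, so that
  \<open>marginal n A (phi n x)\<close> is a nonzero multiple of \<open>x\<close> (\<open>marginal_phi_eq_scaleR\<close>). If
  \<open>x \<in> H_space n A\<close> and some \<open>a \<in> A\<close> is not in \<open>B\<close>, then the marginal on \<open>B\<close> sees a block \<open>\<pi>\<close>
  only through \<open>\<pi>\<close> with \<open>a\<close> deleted, so that \<open>marginal n B (phi n x) = 0\<close>
  (\<open>marginal_phi_eq_0\<close>). Processing the sets \<open>A\<close> by increasing size, one can therefore read off,
  and subtract, the component of \<open>f\<close> in \<open>W_space n A\<close>, until all marginals vanish; the marginal on
  \<open>{1..n}\<close> is \<open>f\<close> itself. This proves both existence and uniqueness of the decomposition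
  (\<open>internal_direct_sum_triangular\<close>). The constants fit into the same scheme as the component of
  the empty set, and one-element sets contribute nothing because \<open>H_space n {a} = {0}\<close>.

  For the dimensions, since \<open>phi n\<close> is injective on \<open>H_space n A\<close>, only \<open>H_space n A\<close> matters.
  The condition of being annihilated by deletions is imposed one letter at a time. On functions
  annihilated by the deletions of all letters in \<open>S\<close>, the deletion of a further letter \<open>a\<close> is
  onto the corresponding space for \<open>A - {a}\<close>: appending \<open>a\<close> at the end of each word is a right
  inverse. Rank-nullity thus yields a recursion for the dimension. Permutations of \<open>A\<close> without fixed
  points in \<open>S\<close> obey the same recursion, because those that fix \<open>a\<close> are the permutations of
  \<open>A - {a}\<close>; and both counts start from \<open>fact (card A)\<close> at \<open>S = {}\<close>. For \<open>S = A\<close> this is the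
  number of derangements.
\<close>

section \<open>Finite-dimensional subspaces of a real vector space\<close>

lemma sum_fun_apply: "(\<Sum>i\<in>I. f i) x = (\<Sum>i\<in>I. f i x)"
  by (induction I rule: infinite_finite_induct) auto

text \<open>
  The space of functions on words is infinite-dimensional as a type, so finite dimension enters
  through a finite set whose span contains the subspace.
\<close>

lemma rank_nullity:
  fixes f :: "'v::real_vector \<Rightarrow> 'w::real_vector"
  assumes f: "linear f" and U: "subspace U" and fin: "finite F" "U \<subseteq> span F"
  shows "dim U = dim {x \<in> U. f x = 0} + dim (f ` U)"
proof -
  define K where "K = {x \<in> U. f x = 0}"
  have K: "subspace K"
    using U unfolding K_def subspace_def
    by (simp add: linear_0[OF f] linear_add[OF f] linear_scale[OF f])
  obtain B where B: "B \<subseteq> K" "independent B" "K \<subseteq> span B"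
    by (rule maximal_independent_subset)
  have "B \<subseteq> U" using B K_def by auto
  then obtain B' where B': "B \<subseteq> B'" "B' \<subseteq> U" "independent B'" "U \<subseteq> span B'"
    using maximal_independent_subset_extend[of B U] B(2) by blast
  define C where "C = B' - B"
  have finB': "finite B'" using independent_span_bound[OF fin(1) B'(3)] B'(2) fin(2) by auto
  have spanU: "span B' = U" using B' U by (simp add: span_subspace)
  have spanK: "span B = K" using B K by (simp add: span_subspace)
  (* An element of the kernel lies in the span of B, and its coordinates cannot be supported on
     both B and the disjoint set C. *)
  have ker_C: "x = 0" if x: "x \<in> span C" "f x = 0" for x
  proof -
    have xU: "x \<in> span B'" using x(1) span_mono[of C B'] by (auto simp: C_def)
    have xB: "x \<in> span B" using x xU spanU spanK by (auto simp: K_def)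
    have "representation B' x = representation B x"
      by (rule representation_extend[OF B'(3) xB B'(1)])
    moreover have "representation B' x = representation C x"
      by (rule representation_extend[OF B'(3) x(1)]) (simp add: C_def)
    ultimately have "representation B' x b = 0" for b
      using representation_ne_zero[of B x b] representation_ne_zero[of C x b]
      by (metis C_def DiffE)
    then show ?thesis
      using sum_nonzero_representation_eq[OF B'(3) xU] by simp
  qed
  have inj: "inj_on f (span C)"
    using linear_inj_on_iff_eq_0[OF f subspace_span] ker_C by blast
  have indC: "independent C"
    using B'(3) independent_mono[of B' C] by (simp add: C_def)
  have indfC: "independent (f ` C)"
    by (rule linear_independent_injective_image[OF f indC inj])
  have fU: "f ` U \<subseteq> span (f ` C)"
  proof
    fix y assume "y \<in> f ` U"
    then obtain x where x: "x \<in> span (B \<union> C)" "y = f x"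
      using spanU B'(1) by (auto simp: C_def Un_absorb1)
    then obtain b c where "x = b + c" "b \<in> span B" "c \<in> span C"
      unfolding span_Un by blast
    then have "y = f c" "c \<in> span C"
      using x(2) spanK by (auto simp: K_def linear_add[OF f])
    then show "y \<in> span (f ` C)" using linear_span_image[OF f] by blast
  qed
  have "dim (f ` U) = card (f ` C)"
    using dim_unique[OF _ fU indfC] B'(2) by (auto simp: C_def)
  also have "\<dots> = card C"
    using inj by (intro card_image) (rule inj_on_subset[OF _ span_superset])
  finally have "dim (f ` U) = card C" .
  moreover have "dim K = card B" using basis_card_eq_dim[OF B(1,3,2)] by simp
  moreover have "dim U = card B'" using basis_card_eq_dim[OF B'(2,4,3)] by simp
  moreover have "card B' = card B + card C"
    using finB' B'(1) by (simp add: C_def card_Diff_subset card_mono finite_subset)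
  ultimately show ?thesis by (simp add: K_def)
qed

lemma dim_injective_image:
  fixes f :: "'v::real_vector \<Rightarrow> 'w::real_vector"
  assumes "linear f" "subspace U" "finite F" "U \<subseteq> span F"
    and ker: "\<And>x. x \<in> U \<Longrightarrow> f x = 0 \<Longrightarrow> x = 0"
  shows "dim (f ` U) = dim U"
proof -
  have "{x \<in> U. f x = 0} = {0}"
    using ker subspace_0[OF assms(2)] linear_0[OF assms(1)] by auto
  moreover have "dim {0::'v} = 0" using dim_le_card[of "{0::'v}" "{}"] by simp
  ultimately show ?thesis using rank_nullity[OF assms(1-4)] by simp
qed

section \<open>Dirac functions\<close>

abbreviation dirac :: "'a \<Rightarrow> 'a \<Rightarrow> real"
  where "dirac e \<equiv> indicator {e}"

lemma dirac_in_Lfun: "e \<in> E \<Longrightarrow> dirac e \<in> Lfun E"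
  by (auto simp: Lfun_def indicator_def)

lemma subspace_Lfun: "subspace (Lfun E)"
  by (auto simp: subspace_def Lfun_def scaleR_fun_def)

lemma indicator_eq_sum_dirac: "finite S \<Longrightarrow> indicator S = (\<Sum>s\<in>S. dirac s)"
  by (rule ext) (auto simp: sum_fun_apply indicator_def)

lemma Lfun_eq_sum_dirac:
  assumes "finite E" "x \<in> Lfun E"
  shows "x = (\<Sum>e\<in>E. x e *\<^sub>R dirac e)"
proof
  fix w
  have "(\<Sum>e\<in>E. x e *\<^sub>R dirac e) w = (\<Sum>e\<in>E. if w = e then x e else 0)"
    by (auto simp: sum_fun_apply scaleR_fun_def indicator_def intro!: sum.cong)
  then show "x w = (\<Sum>e\<in>E. x e *\<^sub>R dirac e) w"
    using assms by (simp add: Lfun_def)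
qed

lemma Lfun_subset_span: "finite E \<Longrightarrow> Lfun E \<subseteq> span (dirac ` E)"
proof
  fix x :: "'a \<Rightarrow> real" assume "finite E" "x \<in> Lfun E"
  then have "x = (\<Sum>e\<in>E. x e *\<^sub>R dirac e)" by (rule Lfun_eq_sum_dirac)
  also have "\<dots> \<in> span (dirac ` E)" by (intro span_sum span_scale span_base) auto
  finally show "x \<in> span (dirac ` E)" .
qed

lemma dim_Lfun:
  assumes "finite E"
  shows "dim (Lfun E) = card E"
proof (rule dim_unique)
  have inj: "inj_on dirac E"
    by (auto simp: inj_on_def fun_eq_iff indicator_def split: if_splits)
  then show "card (dirac ` E) = card E" by (rule card_image)
  show "dirac ` E \<subseteq> Lfun E" using dirac_in_Lfun by auto
  show "Lfun E \<subseteq> span (dirac ` E)" using assms by (rule Lfun_subset_span)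
  show "independent (dirac ` E)"
  proof (rule independent_if_scalars_zero)
    fix g :: "('a \<Rightarrow> real) \<Rightarrow> real" and v
    assume zero: "(\<Sum>v\<in>dirac ` E. g v *\<^sub>R v) = 0" and "v \<in> dirac ` E"
    then obtain e where e: "e \<in> E" "v = dirac e" by blast
    have "0 = (\<Sum>d\<in>E. g (dirac d) *\<^sub>R dirac d) e"
      using zero by (simp add: sum.reindex[OF inj])
    also have "\<dots> = (\<Sum>d\<in>E. if e = d then g (dirac d) else 0)"
      unfolding sum_fun_apply
      by (intro sum.cong) (auto simp: scaleR_fun_def indicator_def)
    also have "\<dots> = g v" using assms e by simp
    finally show "g v = 0" by simp
  qed (use assms in simp)
qed

lemma linear_eq_on_Lfun:
  assumes "finite E" "linear f" "linear g" "x \<in> Lfun E"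
    and "\<And>e. e \<in> E \<Longrightarrow> f (dirac e) = g (dirac e)"
  shows "f x = g x"
proof -
  have "f (\<Sum>e\<in>E. x e *\<^sub>R dirac e) = g (\<Sum>e\<in>E. x e *\<^sub>R dirac e)"
    unfolding linear_sum[OF assms(2)] linear_sum[OF assms(3)]
    by (intro sum.cong refl)
      (simp add: linear_scale[OF assms(2)] linear_scale[OF assms(3)] assms(5))
  then show ?thesis using Lfun_eq_sum_dirac[OF assms(1,4)] by simp
qed

lemma linear_maps_Lfun_into:
  assumes "finite E" "linear f" "x \<in> Lfun E" "subspace V"
    and "\<And>e. e \<in> E \<Longrightarrow> f (dirac e) \<in> V"
  shows "f x \<in> V"
proof -
  have "f (\<Sum>e\<in>E. x e *\<^sub>R dirac e) \<in> V"
    unfolding linear_sum[OF assms(2)] linear_scale[OF assms(2)]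
    by (intro subspace_sum[OF assms(4)] subspace_scale[OF assms(4)] assms(5))
  then show ?thesis using Lfun_eq_sum_dirac[OF assms(1,3)] by simp
qed

lemma linear_linear_extension: "linear (linear_extension E f)"
  by (rule linearI)
    (simp_all add: linear_extension_def scaleR_add_left sum.distrib scaleR_fun_def scaleR_sum_right)

lemma linear_extension_dirac:
  assumes "finite E" "e \<in> E"
  shows "linear_extension E f (dirac e) = f e"
proof -
  have "linear_extension E f (dirac e) = (\<Sum>d\<in>E. if d = e then f d else 0)"
    unfolding linear_extension_def by (intro sum.cong) (auto simp: indicator_def)
  then show ?thesis using assms by simp
qed

section \<open>Direct sums detected by a triangular family of linear maps\<close>

lemma internal_direct_sumI:
  assumes "finite I" "\<And>i. i \<in> I \<Longrightarrow> subspace (U i)" "subspace V" "\<And>i. i \<in> I \<Longrightarrow> U i \<subseteq> V"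
    and indep: "\<And>u i. \<lbrakk>\<And>j. j \<in> I \<Longrightarrow> u j \<in> U j; (\<Sum>j\<in>I. u j) = 0; i \<in> I\<rbrakk> \<Longrightarrow> u i = 0"
    and gen: "\<And>v. v \<in> V \<Longrightarrow> \<exists>u. (\<forall>j\<in>I. u j \<in> U j) \<and> v = (\<Sum>j\<in>I. u j)"
  shows "internal_direct_sum I U V"
  unfolding internal_direct_sum_def
proof (intro conjI ballI bij_betw_imageI)
  show "inj_on (\<lambda>u. \<Sum>i\<in>I. u i) (Pi\<^sub>E I U)"
  proof (rule inj_onI)
    fix u v assume u: "u \<in> Pi\<^sub>E I U" and v: "v \<in> Pi\<^sub>E I U" and eq: "(\<Sum>i\<in>I. u i) = (\<Sum>i\<in>I. v i)"
    show "u = v"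
    proof (rule PiE_ext[OF u v])
      fix i assume i: "i \<in> I"
      have "u i - v i = 0"
        using u v eq i
        by (intro indep[where u = "\<lambda>i. u i - v i"])
          (auto simp: sum_subtractf intro!: subspace_diff assms(2))
      then show "u i = v i" by simp
    qed
  qed
  show "(\<lambda>u. \<Sum>i\<in>I. u i) ` Pi\<^sub>E I U = V"
  proof (intro equalityI subsetI)
    fix v assume "v \<in> (\<lambda>u. \<Sum>i\<in>I. u i) ` Pi\<^sub>E I U"
    then obtain u where "u \<in> Pi\<^sub>E I U" "v = (\<Sum>i\<in>I. u i)" by blast
    then show "v \<in> V" using assms(4) by (auto intro!: subspace_sum[OF assms(3)])
  next
    fix v assume "v \<in> V"
    then obtain u where "\<forall>j\<in>I. u j \<in> U j" "v = (\<Sum>j\<in>I. u j)" using gen by blast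
    then show "v \<in> (\<lambda>u. \<Sum>i\<in>I. u i) ` Pi\<^sub>E I U"
      by (intro image_eqI[where x = "restrict u I"]) auto
  qed
qed (use assms in auto)

text \<open>
  The matrix of the maps \<open>M j\<close> on the subspaces \<open>U i\<close>, ordered by \<open>rank\<close>, is block triangular
  with injective diagonal blocks: \<open>M j\<close> only sees components of smaller rank and the component \<open>j\<close>
  itself. Independence follows by looking at a nonzero component of minimal rank. For generation,
  \<open>lift\<close> provides the components of one rank once those of all smaller ranks have been subtracted,
  and \<open>separating\<close> says that nothing is left at the end.
\<close>

lemma internal_direct_sum_triangular:
  fixes M :: "'i \<Rightarrow> 'v::real_vector \<Rightarrow> 'w::real_vector" and rank :: "'i \<Rightarrow> nat"
  assumes I: "finite I" and U: "\<And>i. i \<in> I \<Longrightarrow> subspace (U i)" and V: "subspace V"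
    and UV: "\<And>i. i \<in> I \<Longrightarrow> U i \<subseteq> V"
    and lin: "\<And>i. i \<in> I \<Longrightarrow> linear (M i)"
    and off_diagonal: "\<And>i j x. \<lbrakk>i \<in> I; j \<in> I; i \<noteq> j; rank j \<le> rank i; x \<in> U i\<rbrakk> \<Longrightarrow> M j x = 0"
    and inj: "\<And>i x. \<lbrakk>i \<in> I; x \<in> U i; M i x = 0\<rbrakk> \<Longrightarrow> x = 0"
    and lift: "\<And>i f. \<lbrakk>i \<in> I; f \<in> V; \<And>j. j \<in> I \<Longrightarrow> rank j < rank i \<Longrightarrow> M j f = 0\<rbrakk>
                 \<Longrightarrow> \<exists>x\<in>U i. M i f = M i x"
    and separating: "\<And>f. \<lbrakk>f \<in> V; \<And>i. i \<in> I \<Longrightarrow> M i f = 0\<rbrakk> \<Longrightarrow> f = 0"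
  shows "internal_direct_sum I U V"
proof (rule internal_direct_sumI[OF I U V UV])
  fix u i
  assume u: "\<And>j. j \<in> I \<Longrightarrow> u j \<in> U j" and zero: "(\<Sum>j\<in>I. u j) = 0" and "i \<in> I"
  from \<open>i \<in> I\<close> show "u i = 0"
  proof (induction "rank i" arbitrary: i rule: less_induct)
    case less
    have "M i (u j) = 0" if "j \<in> I" "j \<noteq> i" for j
    proof (cases "rank j < rank i")
      case True
      then show ?thesis using less that linear_0[OF lin[OF \<open>i \<in> I\<close>]] by simp
    next
      case False
      then show ?thesis using off_diagonal[of j i "u j"] that less.prems u by auto
    qed
    then have "(\<Sum>j\<in>I. M i (u j)) = M i (u i)"
      using I less.prems by (simp add: sum.remove[of I i])
    moreover have "(\<Sum>j\<in>I. M i (u j)) = 0"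
      using linear_sum[OF lin[OF less.prems], of u I] zero linear_0[OF lin[OF less.prems]] by simp
    ultimately show ?case using inj[of i "u i"] less.prems u by simp
  qed
next
  fix v assume v: "v \<in> V"
  (* All components of rank below m can be subtracted from v. *)
  have approx: "\<exists>u. (\<forall>j\<in>I. u j \<in> U j) \<and> (\<forall>j\<in>I. rank j < m \<longrightarrow> M j (v - (\<Sum>i\<in>I. u i)) = 0)" for m
  proof (induction m)
    case 0
    show ?case using U by (auto intro!: exI[of _ "\<lambda>_. 0"] simp: subspace_0)
  next
    case (Suc m)
    then obtain u where u: "\<forall>j\<in>I. u j \<in> U j"
      and res: "\<forall>j\<in>I. rank j < m \<longrightarrow> M j (v - (\<Sum>i\<in>I. u i)) = 0" by blast
    define g where "g = v - (\<Sum>i\<in>I. u i)"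
    have g: "g \<in> V"
      unfolding g_def using u UV v by (intro subspace_diff[OF V] subspace_sum[OF V]) auto
    have "\<exists>x\<in>U i. M i g = M i x" if "i \<in> I" "rank i = m" for i
      using lift[OF that(1) g] res that by (simp add: g_def)
    then have "\<exists>x. \<forall>i\<in>I. rank i = m \<longrightarrow> x i \<in> U i \<and> M i g = M i (x i)"
      by (intro bchoice) blast
    then obtain x where x: "\<And>i. i \<in> I \<Longrightarrow> rank i = m \<Longrightarrow> x i \<in> U i \<and> M i g = M i (x i)"
      by blast
    (* Correcting in rank m does not disturb the maps of smaller rank, by triangularity. *)
    define y where "y i = (if rank i = m then x i else 0)" for i
    have y: "y i \<in> U i" if "i \<in> I" for i using that x U by (simp add: y_def subspace_0)
    have "M j (v - (\<Sum>i\<in>I. u i + y i)) = 0" if j: "j \<in> I" "rank j < Suc m" for j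
    proof -
      have "M j (y i) = 0" if "i \<in> I" "i \<noteq> j" for i
        using off_diagonal[of i j "x i"] x that j linear_0[OF lin[OF j(1)]] by (simp add: y_def)
      then have "(\<Sum>i\<in>I. M j (y i)) = M j (y j)"
        using I j by (simp add: sum.remove[of I j])
      also have "\<dots> = M j g"
        using j res x[of j] linear_0[OF lin[OF j(1)]] by (auto simp: y_def g_def)
      finally have "M j (g - (\<Sum>i\<in>I. y i)) = 0"
        by (simp add: linear_diff[OF lin[OF j(1)]] linear_sum[OF lin[OF j(1)]])
      then show ?thesis by (simp add: g_def sum.distrib algebra_simps)
    qed
    then show ?case
      using u y U by (intro exI[of _ "\<lambda>i. u i + y i"]) (auto intro!: subspace_add)
  qed
  obtain u where u: "\<forall>j\<in>I. u j \<in> U j"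
    and res: "\<And>j. j \<in> I \<Longrightarrow> rank j < Suc (Max (rank ` I)) \<Longrightarrow> M j (v - (\<Sum>i\<in>I. u i)) = 0"
    using approx by blast
  have "v - (\<Sum>i\<in>I. u i) = 0"
  proof (rule separating)
    show "v - (\<Sum>i\<in>I. u i) \<in> V"
      using u UV v by (intro subspace_diff[OF V] subspace_sum[OF V]) auto
    show "M j (v - (\<Sum>i\<in>I. u i)) = 0" if "j \<in> I" for j
      using that I by (intro res) (simp_all add: less_Suc_eq_le)
  qed
  then show "\<exists>u. (\<forall>j\<in>I. u j \<in> U j) \<and> v = (\<Sum>j\<in>I. u j)" using u by auto
qed

section \<open>Words and deletion operators\<close>

lemma words_on_subset_inj_words: "A \<subseteq> {1..n} \<Longrightarrow> words_on A \<subseteq> inj_words n"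
  by (auto simp: words_on_def inj_words_def)

lemma finite_words_on: "finite A \<Longrightarrow> finite (words_on A)"
  using finite_permutations_of_set[of A]
  by (simp add: permutations_of_set_def words_on_def conj_commute)

lemma card_words_on: "finite A \<Longrightarrow> card (words_on A) = fact (card A)"
  using card_permutations_of_set[of A]
  by (simp add: permutations_of_set_def words_on_def conj_commute)

lemma finite_words_on_subset: "A \<subseteq> {1..n} \<Longrightarrow> finite (words_on A)"
  by (rule finite_subset[OF words_on_subset_inj_words finite_inj_words])

lemma words_on_removeAll: "\<pi> \<in> words_on A \<Longrightarrow> removeAll a \<pi> \<in> words_on (A - {a})"
  by (auto simp: words_on_def distinct_removeAll)

lemma removeAll_commute: "removeAll a (removeAll b w) = removeAll b (removeAll a w)"
  by (induction w) auto

lemma linear_deletion: "linear (deletion n a)"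
  unfolding deletion_def by (rule linear_linear_extension)

lemma deletion_dirac: "\<pi> \<in> inj_words n \<Longrightarrow> deletion n a (dirac \<pi>) = dirac (removeAll a \<pi>)"
  by (simp add: deletion_def linear_extension_dirac finite_inj_words)

lemma deletion_in_Lfun:
  assumes "A \<subseteq> {1..n}" "x \<in> Lfun (words_on A)"
  shows "deletion n a x \<in> Lfun (words_on (A - {a}))"
proof (rule linear_maps_Lfun_into[OF _ linear_deletion assms(2) subspace_Lfun])
  show "finite (words_on A)" by (rule finite_words_on_subset[OF assms(1)])
  show "deletion n a (dirac e) \<in> Lfun (words_on (A - {a}))" if "e \<in> words_on A" for e
    using that words_on_subset_inj_words[OF assms(1)] deletion_dirac[of e n a]
      dirac_in_Lfun[OF words_on_removeAll[OF that]] by auto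
qed

lemma deletion_commute:
  assumes "A \<subseteq> {1..n}" "x \<in> Lfun (words_on A)"
  shows "deletion n a (deletion n b x) = deletion n b (deletion n a x)"
proof -
  have fin: "finite (words_on A)" by (rule finite_words_on_subset[OF assms(1)])
  have inj: "removeAll c e \<in> inj_words n" if "e \<in> words_on A" for c e
    using that assms(1) by (auto simp: words_on_def inj_words_def distinct_removeAll)
  have "(deletion n a \<circ> deletion n b) x = (deletion n b \<circ> deletion n a) x"
    by (rule linear_eq_on_Lfun[OF fin
          linear_compose[OF linear_deletion linear_deletion]
          linear_compose[OF linear_deletion linear_deletion] assms(2)])
      (simp add: deletion_dirac inj
        subsetD[OF words_on_subset_inj_words[OF assms(1)]] removeAll_commute)
  then show ?thesis by simp
qed

text \<open>
  The linear map that sends the Dirac function of \<open>w\<close> to that of \<open>w @ [a]\<close>, written pointwise so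
  that it is linear on all functions, also those of infinite support.
\<close>

definition append_letter :: "'a \<Rightarrow> ('a list \<Rightarrow> real) \<Rightarrow> 'a list \<Rightarrow> real"
  where "append_letter a z = (\<lambda>w. if w \<noteq> [] \<and> last w = a then z (butlast w) else 0)"

lemma linear_append_letter: "linear (append_letter a)"
  by (rule linearI) (auto simp: append_letter_def scaleR_fun_def fun_eq_iff)

lemma append_letter_dirac: "append_letter a (dirac w) = dirac (w @ [a])"
  by (auto simp: append_letter_def fun_eq_iff indicator_def)

lemma append_letter_in_Lfun:
  assumes "a \<in> A" "z \<in> Lfun (words_on (A - {a}))"
  shows "append_letter a z \<in> Lfun (words_on A)"
proof -
  have "z (butlast w) = 0" if w: "w \<noteq> []" "last w = a" "w \<notin> words_on A" for w
  proof -
    have "w = butlast w @ [a]" using w(1,2) append_butlast_last_id[of w] by simp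
    moreover have "v @ [a] \<in> words_on A" if "v \<in> words_on (A - {a})" for v
      using that assms(1) by (auto simp: words_on_def)
    ultimately have "butlast w \<notin> words_on (A - {a})" using w(3) by metis
    then show ?thesis using assms(2) by (simp add: Lfun_def)
  qed
  then show ?thesis by (auto simp: Lfun_def append_letter_def)
qed

section \<open>The dimension of the spaces annihilated by deletions\<close>

text \<open>
  This interpolates between all functions on words with content \<open>A\<close>, at \<open>S = {}\<close>, and
  \<open>H_space n A\<close>, at \<open>S = A\<close>.
\<close>

definition annihilated_by :: "nat \<Rightarrow> nat set \<Rightarrow> nat set \<Rightarrow> (nat list \<Rightarrow> real) set"
  where "annihilated_by n A S = {x \<in> Lfun (words_on A). \<forall>a\<in>S. deletion n a x = 0}"

lemma subspace_annihilated_by: "subspace (annihilated_by n A S)"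
  using subspace_Lfun[of "words_on A"] unfolding annihilated_by_def subspace_def
  by (simp add: linear_0[OF linear_deletion] linear_add[OF linear_deletion]
      linear_scale[OF linear_deletion])

text \<open>
  Deletions commute, which gives one inclusion. For the other, appending \<open>a\<close> is a right inverse of
  the deletion of \<open>a\<close> and commutes with the deletion of every other letter, so it preserves the
  conditions indexed by \<open>S\<close>.
\<close>

lemma deletion_image_annihilated_by:
  assumes A: "A \<subseteq> {1..n}" and a: "a \<in> A" "a \<notin> S"
  shows "deletion n a ` annihilated_by n A S = annihilated_by n (A - {a}) S"
proof (intro equalityI subsetI)
  fix y assume "y \<in> deletion n a ` annihilated_by n A S"
  then obtain x where x: "x \<in> Lfun (words_on A)" "\<And>b. b \<in> S \<Longrightarrow> deletion n b x = 0"
    and y: "y = deletion n a x" by (auto simp: annihilated_by_def)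
  then show "y \<in> annihilated_by n (A - {a}) S"
    using deletion_in_Lfun[OF A x(1)]
    by (simp add: annihilated_by_def deletion_commute[OF A x(1), of _ a] linear_0[OF linear_deletion])
next
  fix z assume "z \<in> annihilated_by n (A - {a}) S"
  then have z: "z \<in> Lfun (words_on (A - {a}))" "\<And>b. b \<in> S \<Longrightarrow> deletion n b z = 0"
    by (auto simp: annihilated_by_def)
  have fin: "finite (words_on (A - {a}))"
    by (rule finite_words_on_subset) (use A in blast)
  have inj: "e \<in> inj_words n" "e @ [a] \<in> inj_words n" "a \<notin> set e" if "e \<in> words_on (A - {a})" for e
    using that A a by (auto simp: words_on_def inj_words_def)
  have "(deletion n a \<circ> append_letter a) z = id z"
    by (rule linear_eq_on_Lfun[OF fin
          linear_compose[OF linear_append_letter linear_deletion] linear_id z(1)])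
      (simp add: append_letter_dirac deletion_dirac inj)
  moreover have "deletion n b (append_letter a z) = 0" if "b \<in> S" for b
  proof -
    have "b \<noteq> a" using a(2) that by blast
    have "(deletion n b \<circ> append_letter a) z = (append_letter a \<circ> deletion n b) z"
      by (rule linear_eq_on_Lfun[OF fin
            linear_compose[OF linear_append_letter linear_deletion]
            linear_compose[OF linear_deletion linear_append_letter] z(1)])
        (simp add: append_letter_dirac deletion_dirac inj \<open>b \<noteq> a\<close>)
    then show ?thesis using z(2)[OF that] by (simp add: linear_0[OF linear_append_letter])
  qed
  ultimately show "z \<in> deletion n a ` annihilated_by n A S"
    using append_letter_in_Lfun[OF a(1) z(1)]
    by (intro image_eqI[where x = "append_letter a z"]) (auto simp: annihilated_by_def)
qed

lemma dim_annihilated_by_split: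
  assumes A: "A \<subseteq> {1..n}" and a: "a \<in> A" "a \<notin> S"
  shows "dim (annihilated_by n A S) =
         dim (annihilated_by n A (insert a S)) + dim (annihilated_by n (A - {a}) S)"
proof -
  have fin: "finite (words_on A)" by (rule finite_words_on_subset[OF A])
  have "annihilated_by n A S \<subseteq> span (dirac ` words_on A)"
    using Lfun_subset_span[OF fin] by (auto simp: annihilated_by_def)
  from rank_nullity[OF linear_deletion[of n a] subspace_annihilated_by _ this] fin
  show ?thesis
    unfolding deletion_image_annihilated_by[OF assms]
    by (simp add: annihilated_by_def conj_ac)
qed

definition moving :: "'a set \<Rightarrow> 'a set \<Rightarrow> ('a \<Rightarrow> 'a) set"
  where "moving A S = {p. p permutes A \<and> (\<forall>i\<in>S. p i \<noteq> i)}"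

lemma permutes_Diff_singleton_iff:
  "a \<in> A \<Longrightarrow> p permutes A - {a} \<longleftrightarrow> p permutes A \<and> p a = a"
  by (auto simp: permutes_def)

text \<open>
  The permutations counted by \<open>moving A S\<close> either move \<open>a\<close> or are permutations of \<open>A - {a}\<close>; the
  recursion matches that of \<open>dim_annihilated_by_split\<close>.
\<close>

lemma card_moving_split:
  assumes "finite A" "a \<in> A" "a \<notin> S"
  shows "card (moving A S) = card (moving A (insert a S)) + card (moving (A - {a}) S)"
proof -
  have "moving A S = moving A (insert a S) \<union> moving (A - {a}) S"
    using permutes_Diff_singleton_iff[OF assms(2)] by (auto simp: moving_def)
  moreover have "moving A (insert a S) \<inter> moving (A - {a}) S = {}"
    using permutes_Diff_singleton_iff[OF assms(2)] by (auto simp: moving_def)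
  moreover have "finite (moving A' S')" if "A' \<subseteq> A" for A' S'
    using finite_permutations[OF finite_subset[OF that assms(1)]]
    by (rule finite_subset[rotated]) (auto simp: moving_def)
  ultimately show ?thesis by (simp add: card_Un_disjoint)
qed

text \<open>
  The \<open>s\<close>-fold backward difference of the factorial at \<open>m\<close>, for \<open>s \<le> m\<close>. It serves as the common
  value of the two counts and shows that they depend on the cardinalities only.
\<close>

fun factorial_difference :: "nat \<Rightarrow> nat \<Rightarrow> int" where
  "factorial_difference 0 m = fact m"
| "factorial_difference (Suc s) m = factorial_difference s m - factorial_difference s (m - 1)"

lemma eq_factorial_difference:
  fixes h :: "'a set \<Rightarrow> 'a set \<Rightarrow> nat"
  assumes "finite X"
    and base: "\<And>A. A \<subseteq> X \<Longrightarrow> h A {} = fact (card A)"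
    and split: "\<And>A S a. \<lbrakk>A \<subseteq> X; S \<subseteq> A; a \<in> A; a \<notin> S\<rbrakk>
                  \<Longrightarrow> h A S = h A (insert a S) + h (A - {a}) S"
    and "S \<subseteq> A" "A \<subseteq> X"
  shows "int (h A S) = factorial_difference (card S) (card A)"
proof -
  have "finite S" using finite_subset[of S X] assms(1,4,5) by simp
  then show ?thesis using assms(4,5)
  proof (induction S arbitrary: A)
    case empty
    then show ?case by (simp add: base)
  next
    case (insert a S)
    have "int (h A (insert a S)) = int (h A S) - int (h (A - {a}) S)"
      using split[of A S a] insert by simp
    also have "\<dots> = factorial_difference (card S) (card A)
                  - factorial_difference (card S) (card (A - {a}))"
      using insert.IH[of A] insert.IH[of "A - {a}"] insert.prems insert.hyps(2)
      by (auto simp: subset_Diff_insert simp del: card_Diff_insert card_Diff_singleton)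
    also have "\<dots> = factorial_difference (card (insert a S)) (card A)"
      using insert by simp
    finally show ?case .
  qed
qed

lemma dim_H_space:
  assumes "A \<subseteq> {1..n}"
  shows "dim (H_space n A) = card (derangements (card A))"
proof -
  have "int (dim (annihilated_by n A A)) = factorial_difference (card A) (card A)"
  proof (rule eq_factorial_difference[where X = "{1..n}" and h = "\<lambda>A S. dim (annihilated_by n A S)"])
    show "dim (annihilated_by n B {}) = fact (card B)" if "B \<subseteq> {1..n}" for B
      using dim_Lfun[of "words_on B"] finite_words_on[of B] card_words_on[of B]
        finite_subset[OF that] by (simp add: annihilated_by_def)
  qed (use assms dim_annihilated_by_split in auto)
  moreover have "int (card (moving B B)) = factorial_difference (card B) (card B)" if "finite B"
    for B :: "nat set"
  proof (rule eq_factorial_difference[OF that, where h = "\<lambda>A S. card (moving A S)"])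
    show "card (moving C {}) = fact (card C)" if "C \<subseteq> B" for C
      using card_permutations[OF refl finite_subset[OF that \<open>finite B\<close>]]
      by (simp add: moving_def)
    show "card (moving C S) = card (moving C (insert a S)) + card (moving (C - {a}) S)"
      if "C \<subseteq> B" "S \<subseteq> C" "a \<in> C" "a \<notin> S" for C S a
      using card_moving_split[OF finite_subset[OF that(1) \<open>finite B\<close>]] that by blast
  qed auto
  from this[of "{1..card A}"]
  have "int (card (derangements (card A))) = factorial_difference (card A) (card A)"
    by (simp add: derangements_def moving_def)
  moreover have "H_space n A = annihilated_by n A A"
    by (simp add: H_space_def annihilated_by_def)
  ultimately show ?thesis by simp
qed

section \<open>Marginals\<close>

definition marginal :: "nat \<Rightarrow> nat set \<Rightarrow> (nat list \<Rightarrow> real) \<Rightarrow> nat list \<Rightarrow> real"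
  where "marginal n A = linear_extension (perm_words n) (\<lambda>\<sigma>. dirac (filter (\<lambda>i. i \<in> A) \<sigma>))"

lemma linear_marginal: "linear (marginal n A)"
  unfolding marginal_def by (rule linear_linear_extension)

lemma linear_phi: "linear (phi n)"
  unfolding phi_def by (rule linear_linear_extension)

lemma finite_perm_words: "finite (perm_words n)"
  by (intro finite_words_on) simp

lemma marginal_dirac:
  "\<sigma> \<in> perm_words n \<Longrightarrow> marginal n A (dirac \<sigma>) = dirac (filter (\<lambda>i. i \<in> A) \<sigma>)"
  unfolding marginal_def by (rule linear_extension_dirac[OF finite_perm_words])

lemma words_on_filter: "\<sigma> \<in> words_on B \<Longrightarrow> A \<subseteq> B \<Longrightarrow> filter (\<lambda>i. i \<in> A) \<sigma> \<in> words_on A"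
  by (auto simp: words_on_def)

lemma marginal_in_Lfun:
  assumes "A \<subseteq> {1..n}" "f \<in> Lfun (perm_words n)"
  shows "marginal n A f \<in> Lfun (words_on A)"
proof (rule linear_maps_Lfun_into[OF finite_perm_words linear_marginal assms(2) subspace_Lfun])
  show "marginal n A (dirac \<sigma>) \<in> Lfun (words_on A)" if "\<sigma> \<in> perm_words n" for \<sigma>
    unfolding marginal_dirac[OF that] by (rule dirac_in_Lfun[OF words_on_filter[OF that assms(1)]])
qed

lemma marginal_full: "f \<in> Lfun (perm_words n) \<Longrightarrow> marginal n {1..n} f = f"
proof -
  assume f: "f \<in> Lfun (perm_words n)"
  have id: "filter (\<lambda>i. i \<in> {1..n}) \<sigma> = \<sigma>" if "\<sigma> \<in> perm_words n" for \<sigma>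
    using that by (auto simp: words_on_def intro!: filter_True)
  have "marginal n {1..n} f = id f"
    by (rule linear_eq_on_Lfun[OF finite_perm_words linear_marginal linear_id f])
      (simp only: marginal_dirac id id_apply)
  then show ?thesis by simp
qed

text \<open>
  Inducing a word on \<open>A\<close> and then deleting \<open>a\<close> is inducing it on \<open>A - {a}\<close>. This compatibility is
  what puts the marginal on \<open>A\<close> into \<open>H_space n A\<close> once the smaller marginals vanish.
\<close>

lemma deletion_marginal:
  assumes "A \<subseteq> {1..n}" "f \<in> Lfun (perm_words n)"
  shows "deletion n a (marginal n A f) = marginal n (A - {a}) f"
proof -
  have del: "removeAll a (filter (\<lambda>i. i \<in> A) \<sigma>) = filter (\<lambda>i. i \<in> A - {a}) \<sigma>" for \<sigma>
    by (induction \<sigma>) auto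
  have inj: "filter (\<lambda>i. i \<in> A) \<sigma> \<in> inj_words n" if "\<sigma> \<in> perm_words n" for \<sigma>
    by (rule subsetD[OF words_on_subset_inj_words[OF assms(1)] words_on_filter[OF that assms(1)]])
  have "(deletion n a \<circ> marginal n A) f = marginal n (A - {a}) f"
    by (rule linear_eq_on_Lfun[OF finite_perm_words
          linear_compose[OF linear_marginal linear_deletion] linear_marginal assms(2)])
      (simp only: o_apply marginal_dirac deletion_dirac inj del)
  then show ?thesis by simp
qed

lemma marginal_in_H_space:
  assumes "A \<subseteq> {1..n}" "f \<in> Lfun (perm_words n)" "\<And>a. a \<in> A \<Longrightarrow> marginal n (A - {a}) f = 0"
  shows "marginal n A f \<in> H_space n A"
  using assms marginal_in_Lfun deletion_marginal by (simp add: H_space_def)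

text \<open>
  Deleting the only letter of the only word \<open>[a]\<close> loses no information. Therefore one-element
  sets are absent from the decomposition.
\<close>

lemma H_space_singleton:
  assumes "a \<in> {1..n}"
  shows "H_space n {a} = {0}"
proof -
  have "words_on {a} = {[a]}"
  proof (intro equalityI subsetI)
    fix w assume w: "w \<in> words_on {a}"
    then have "length w = 1" using distinct_card[of w] by (simp add: words_on_def)
    then obtain b where "w = [b]" by (auto simp: length_Suc_conv)
    then show "w \<in> {[a]}" using w by (simp add: words_on_def)
  qed (simp add: words_on_def)
  then have L: "x = x [a] *\<^sub>R dirac [a]" if "x \<in> Lfun (words_on {a})" for x
    using Lfun_eq_sum_dirac[OF _ that] by simp
  have "x = 0" if x: "x \<in> H_space n {a}" for x
  proof -
    have "x = x [a] *\<^sub>R dirac [a]" using x L by (simp add: H_space_def)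
    moreover have "deletion n a x = 0" using x by (simp add: H_space_def)
    ultimately have "x [a] *\<^sub>R deletion n a (dirac [a]) = 0"
      by (metis linear_scale[OF linear_deletion])
    then have "x [a] *\<^sub>R dirac ([] :: nat list) = (0 :: nat list \<Rightarrow> real)"
      using assms by (simp add: deletion_dirac inj_words_def)
    then have "x [a] = 0"
      by (drule_tac x = "[]" in fun_cong) (simp add: scaleR_fun_def)
    then show "x = 0" using \<open>x = x [a] *\<^sub>R dirac [a]\<close> by (metis scaleR_zero_left)
  qed
  moreover have "0 \<in> H_space n {a}"
    by (simp add: H_space_def subspace_0[OF subspace_Lfun] linear_0[OF linear_deletion])
  ultimately show ?thesis by blast
qed

section \<open>Marginals of contiguous embeddings\<close>

lemma perm_words_containing_subset: "perm_words_containing n \<pi> \<subseteq> perm_words n"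
  by (auto simp: perm_words_containing_def)

lemma finite_perm_words_containing: "finite (perm_words_containing n \<pi>)"
  using perm_words_containing_subset finite_perm_words by (rule finite_subset)

lemma phi_dirac: "\<pi> \<in> inj_words n \<Longrightarrow> phi n (dirac \<pi>) = indicator (perm_words_containing n \<pi>)"
  unfolding phi_def by (rule linear_extension_dirac[OF finite_inj_words])

lemma phi_in_Lfun: "phi n x \<in> Lfun (perm_words n)"
  using perm_words_containing_subset[of n]
  unfolding phi_def linear_extension_def
  by (intro subspace_sum[OF subspace_Lfun] subspace_scale[OF subspace_Lfun])
    (auto simp: Lfun_def indicator_def)

lemma marginal_phi_dirac:
  assumes "\<pi> \<in> inj_words n"
  shows "marginal n A (phi n (dirac \<pi>)) =
         (\<Sum>\<sigma>\<in>perm_words_containing n \<pi>. dirac (filter (\<lambda>i. i \<in> A) \<sigma>))"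
  using perm_words_containing_subset[of n \<pi>]
  by (simp add: phi_dirac[OF assms] indicator_eq_sum_dirac[OF finite_perm_words_containing]
      linear_sum[OF linear_marginal] marginal_dirac subset_iff)

text \<open>
  The ways to complete a block with content \<open>A\<close> to a permutation; they depend on the block only
  through its content.
\<close>

definition contexts :: "nat \<Rightarrow> nat set \<Rightarrow> (nat list \<times> nat list) set"
  where "contexts n A = {(\<omega>\<^sub>1, \<omega>\<^sub>2). \<omega>\<^sub>1 @ \<omega>\<^sub>2 \<in> words_on ({1..n} - A)}"

text \<open>
  A nonempty block occurs only once in a permutation, since the part before it is the longest prefix
  without letters of \<open>A\<close>. For the empty block the position would be ambiguous.
\<close>

lemma bij_betw_contexts:
  assumes "A \<subseteq> {1..n}" "A \<noteq> {}" "\<pi> \<in> words_on A"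
  shows "bij_betw (\<lambda>(\<omega>\<^sub>1, \<omega>\<^sub>2). \<omega>\<^sub>1 @ \<pi> @ \<omega>\<^sub>2) (contexts n A) (perm_words_containing n \<pi>)"
proof (rule bij_betw_imageI)
  have before: "takeWhile (\<lambda>i. i \<notin> A) (\<omega>\<^sub>1 @ \<pi> @ \<omega>\<^sub>2) = \<omega>\<^sub>1" if "(\<omega>\<^sub>1, \<omega>\<^sub>2) \<in> contexts n A" for \<omega>\<^sub>1 \<omega>\<^sub>2
  proof -
    have "takeWhile (\<lambda>i. i \<notin> A) (\<pi> @ \<omega>\<^sub>2) = []"
      using assms(2,3) by (cases \<pi>) (auto simp: words_on_def)
    then show ?thesis
      using that by (subst takeWhile_append2) (auto simp: contexts_def words_on_def)
  qed
  show "inj_on (\<lambda>(\<omega>\<^sub>1, \<omega>\<^sub>2). \<omega>\<^sub>1 @ \<pi> @ \<omega>\<^sub>2) (contexts n A)"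
  proof (rule inj_onI, clarify)
    fix u v u' v'
    assume "(u, v) \<in> contexts n A" "(u', v') \<in> contexts n A" and eq: "u @ \<pi> @ v = u' @ \<pi> @ v'"
    then have "u = u'" using before by metis
    then show "u = u' \<and> v = v'" using eq by simp
  qed
  have "\<omega>\<^sub>1 @ \<pi> @ \<omega>\<^sub>2 \<in> perm_words n \<longleftrightarrow> (\<omega>\<^sub>1, \<omega>\<^sub>2) \<in> contexts n A" for \<omega>\<^sub>1 \<omega>\<^sub>2
    using assms(1,3) by (auto simp: contexts_def words_on_def)
  moreover have "\<omega>\<^sub>1 \<in> inj_words n \<and> \<omega>\<^sub>2 \<in> inj_words n" if "(\<omega>\<^sub>1, \<omega>\<^sub>2) \<in> contexts n A" for \<omega>\<^sub>1 \<omega>\<^sub>2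
    using that by (auto simp: contexts_def words_on_def inj_words_def)
  ultimately show "(\<lambda>(\<omega>\<^sub>1, \<omega>\<^sub>2). \<omega>\<^sub>1 @ \<pi> @ \<omega>\<^sub>2) ` contexts n A = perm_words_containing n \<pi>"
    by (fastforce simp: perm_words_containing_def)
qed

text \<open>
  Let \<open>a \<in> A - B\<close>. The marginal on \<open>B\<close> of \<open>phi n (dirac \<pi>)\<close> is a sum over the contexts, which do not
  depend on \<open>\<pi>\<close>, of words into which \<open>\<pi>\<close> enters only through its letters in \<open>B\<close>, hence only
  through \<open>removeAll a \<pi>\<close>. So this marginal factors through the deletion of \<open>a\<close>, which kills \<open>x\<close>.
\<close>

lemma marginal_phi_eq_0:
  assumes A: "A \<subseteq> {1..n}" and "\<not> A \<subseteq> B" and x: "x \<in> H_space n A"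
  shows "marginal n B (phi n x) = 0"
proof -
  obtain a where a: "a \<in> A" "a \<notin> B" using assms(2) by blast
  (* What the marginal on B makes of a block whose letter a is already deleted. *)
  define G where "G = linear_extension (words_on (A - {a})) (\<lambda>\<rho>. \<Sum>(\<omega>\<^sub>1, \<omega>\<^sub>2)\<in>contexts n A.
    dirac (filter (\<lambda>i. i \<in> B) \<omega>\<^sub>1 @ filter (\<lambda>i. i \<in> B) \<rho> @ filter (\<lambda>i. i \<in> B) \<omega>\<^sub>2))"
  have G: "linear G" unfolding G_def by (rule linear_linear_extension)
  have fin: "finite (words_on C)" if "C \<subseteq> A" for C
    by (rule finite_words_on_subset[OF order_trans[OF that A]])
  have xL: "x \<in> Lfun (words_on A)" and del: "deletion n a x = 0"
    using x a by (auto simp: H_space_def)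
  have "(marginal n B \<circ> phi n) x = (G \<circ> deletion n a) x"
  proof (rule linear_eq_on_Lfun[OF fin[OF order_refl]
        linear_compose[OF linear_phi linear_marginal] linear_compose[OF linear_deletion G] xL])
    fix \<pi> assume \<pi>: "\<pi> \<in> words_on A"
    then have inj: "\<pi> \<in> inj_words n" using words_on_subset_inj_words[OF A] by blast
    have del_B: "filter (\<lambda>i. i \<in> B) (removeAll a \<pi>) = filter (\<lambda>i. i \<in> B) \<pi>"
      using a(2) by (induction \<pi>) auto
    have "A \<noteq> {}" using a(1) by blast
    have "(marginal n B \<circ> phi n) (dirac \<pi>) =
        (\<Sum>\<sigma>\<in>perm_words_containing n \<pi>. dirac (filter (\<lambda>i. i \<in> B) \<sigma>))"
      by (simp only: o_apply marginal_phi_dirac[OF inj])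
    also have "\<dots> = (\<Sum>(\<omega>\<^sub>1, \<omega>\<^sub>2)\<in>contexts n A. dirac (filter (\<lambda>i. i \<in> B) (\<omega>\<^sub>1 @ \<pi> @ \<omega>\<^sub>2)))"
      unfolding sum.reindex_bij_betw[OF bij_betw_contexts[OF A \<open>A \<noteq> {}\<close> \<pi>], symmetric]
      by (simp only: case_prod_unfold)
    also have "\<dots> = G (dirac (removeAll a \<pi>))"
      unfolding G_def linear_extension_dirac[OF fin[OF Diff_subset] words_on_removeAll[OF \<pi>]]
      by (simp only: del_B filter_append)
    finally show "(marginal n B \<circ> phi n) (dirac \<pi>) = (G \<circ> deletion n a) (dirac \<pi>)"
      by (simp add: deletion_dirac[OF inj])
  qed
  then show ?thesis by (simp add: del linear_0[OF G])
qed

text \<open>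
  For nonempty \<open>A\<close> this is the number of contexts, \<open>fact (n - card A + 1)\<close>; for the empty set, all
  permutations are counted.
\<close>

lemma card_perm_words_containing_const:
  assumes A: "A \<subseteq> {1..n}"
  shows "\<exists>c>0. \<forall>\<pi>\<in>words_on A. card (perm_words_containing n \<pi>) = c"
proof (cases "A = {}")
  case True
  have "perm_words n \<noteq> {}"
    using card_words_on[of "{1..n}"] by force
  moreover have "perm_words_containing n [] = perm_words n"
    by (force simp: perm_words_containing_def words_on_def inj_words_def)
  ultimately have "card (perm_words_containing n []) > 0"
    using finite_perm_words[of n] by (simp add: card_gt_0_iff)
  then show ?thesis using True by (simp add: words_on_def)
next
  case False
  have "words_on ({1..n} - A) \<noteq> {}"
    using card_words_on[of "{1..n} - A"] by force
  then have "contexts n A \<noteq> {}"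
    unfolding contexts_def by (metis (mono_tags, lifting) append_Nil case_prodI empty_iff ex_in_conv mem_Collect_eq)
  have eq: "card (perm_words_containing n \<pi>) = card (contexts n A)" if "\<pi> \<in> words_on A" for \<pi>
    using bij_betw_same_card[OF bij_betw_contexts[OF A False that]] by simp
  have "words_on A \<noteq> {}"
    using card_words_on[of A] finite_subset[OF A] by force
  then obtain \<pi> where "\<pi> \<in> words_on A" by blast
  then have "finite (contexts n A)"
    using bij_betw_finite[OF bij_betw_contexts[OF A False]] finite_perm_words_containing by blast
  then have "card (contexts n A) > 0"
    using \<open>contexts n A \<noteq> {}\<close> by (simp add: card_gt_0_iff)
  then show ?thesis using eq by blast
qed

text \<open>
  A permutation that contains \<open>\<pi>\<close> as a block induces \<open>\<pi>\<close> on its content, so \<open>marginal n A\<close> undoes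
  \<open>phi n\<close> up to the number of such permutations.
\<close>

lemma marginal_phi_eq_scaleR:
  assumes A: "A \<subseteq> {1..n}"
  shows "\<exists>c::real. c \<noteq> 0 \<and> (\<forall>x\<in>Lfun (words_on A). marginal n A (phi n x) = c *\<^sub>R x)"
proof -
  obtain c where c: "c > 0" "\<And>\<pi>. \<pi> \<in> words_on A \<Longrightarrow> card (perm_words_containing n \<pi>) = c"
    using card_perm_words_containing_const[OF A] by blast
  have fin: "finite (words_on A)" by (rule finite_words_on_subset[OF A])
  have "marginal n A (phi n x) = real c *\<^sub>R x" if x: "x \<in> Lfun (words_on A)" for x
  proof -
    have "(marginal n A \<circ> phi n) x = (\<lambda>x. real c *\<^sub>R x) x"
    proof (rule linear_eq_on_Lfun[OF fin linear_compose[OF linear_phi linear_marginal]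
          linear_scale_self x])
      fix \<pi> assume \<pi>: "\<pi> \<in> words_on A"
      have "filter (\<lambda>i. i \<in> A) \<sigma> = \<pi>" if mem: "\<sigma> \<in> perm_words_containing n \<pi>" for \<sigma>
      proof -
        obtain u v where \<sigma>: "\<sigma> = u @ \<pi> @ v" "distinct \<sigma>"
          using mem unfolding perm_words_containing_def words_on_def by blast
        then have "filter (\<lambda>i. i \<in> A) u = []" "filter (\<lambda>i. i \<in> A) v = []"
          "filter (\<lambda>i. i \<in> A) \<pi> = \<pi>"
          using \<pi> by (auto simp: words_on_def filter_empty_conv filter_id_conv)
        then show ?thesis by (simp add: \<sigma>(1))
      qed
      then have "(\<Sum>\<sigma>\<in>perm_words_containing n \<pi>. dirac (filter (\<lambda>i. i \<in> A) \<sigma>)) = real c *\<^sub>R dirac \<pi>"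
        using c(2)[OF \<pi>] by (simp add: sum_constant_scaleR del: sum_constant)
      then show "(marginal n A \<circ> phi n) (dirac \<pi>) = real c *\<^sub>R dirac \<pi>"
        using \<pi> words_on_subset_inj_words[OF A] marginal_phi_dirac[of \<pi> n A] by auto
    qed
    then show ?thesis by simp
  qed
  then show ?thesis using c(1) by (intro exI[of _ "real c"]) simp
qed

section \<open>The decomposition\<close>

lemma subspace_H_space: "subspace (H_space n A)"
  using subspace_annihilated_by[of n A A] by (simp add: annihilated_by_def H_space_def)

text \<open>
  Every permutation contains the empty word as a block, so \<open>phi n\<close> turns the Dirac function of the
  empty word into a constant function.
\<close>

lemma V0_eq_W_space: "V0 n = W_space n {}"
proof -
  have "words_on {} = {[]}" by (auto simp: words_on_def)
  then have H: "H_space n {} = range (\<lambda>c. c *\<^sub>R dirac [])"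
  proof (intro equalityI subsetI)
    fix x assume "x \<in> H_space n {}"
    then have "x = x [] *\<^sub>R dirac []"
      using Lfun_eq_sum_dirac[of "{[]}" x] \<open>words_on {} = {[]}\<close> by (simp add: H_space_def)
    then show "x \<in> range (\<lambda>c. c *\<^sub>R dirac [])" by blast
  qed (auto simp: H_space_def \<open>words_on {} = {[]}\<close> Lfun_def scaleR_fun_def)
  have "perm_words_containing n [] = perm_words n"
    by (force simp: perm_words_containing_def words_on_def inj_words_def)
  then have "phi n (c *\<^sub>R dirac []) = c *\<^sub>R indicator (perm_words n)" for c
    by (simp add: linear_scale[OF linear_phi] phi_dirac inj_words_def)
  then have "W_space n {} = range (\<lambda>c. c *\<^sub>R indicator (perm_words n))"
    by (simp add: W_space_def H image_image)
  also have "\<dots> = V0 n"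
  proof (intro equalityI subsetI)
    fix x assume "x \<in> V0 n"
    then obtain c where "\<forall>\<sigma>\<in>perm_words n. x \<sigma> = c" "\<forall>\<sigma>. \<sigma> \<notin> perm_words n \<longrightarrow> x \<sigma> = 0"
      by (auto simp: V0_def Lfun_def)
    then have "x = c *\<^sub>R indicator (perm_words n)"
      by (auto simp: scaleR_fun_def fun_eq_iff indicator_def)
    then show "x \<in> range (\<lambda>c. c *\<^sub>R indicator (perm_words n))" by blast
  qed (auto simp: V0_def Lfun_def scaleR_fun_def)
  finally show ?thesis by simp
qed

text \<open>
  The index sets of the decomposition omit the one-element sets, so the marginals on those have to
  be controlled by the marginal on the empty set: they lie in \<open>H_space n {b} = {0}\<close>.
\<close>

lemma marginal_eq_0_of_smaller:
  assumes A: "A \<subseteq> {1..n}" and f: "f \<in> Lfun (perm_words n)" and a: "a \<in> A"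
    and zero: "\<And>B. \<lbrakk>B = {} \<or> B \<in> subsets_ge2 {1..n}; card B < card A\<rbrakk> \<Longrightarrow> marginal n B f = 0"
  shows "marginal n (A - {a}) f = 0"
proof -
  have finA: "finite A" by (rule finite_subset[OF A]) simp
  have less: "card (A - {a}) < card A" using finA a by (rule card_Diff1_less)
  consider "A - {a} = {}" | "2 \<le> card (A - {a})" | "card (A - {a}) = 1"
    using finA by (metis One_nat_def Suc_1 card_0_eq finite_Diff le_less_Suc_eq less_2_cases not_less)
  then show ?thesis
  proof cases
    case 3
    then obtain b where b: "A - {a} = {b}" by (auto simp: card_1_singleton_iff)
    then have "b \<in> {1..n}" using A by auto
    moreover have "marginal n {} f = 0" using zero less by auto
    ultimately have "marginal n {b} f \<in> H_space n {b}"
      using f by (intro marginal_in_H_space) auto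
    then show ?thesis using H_space_singleton[OF \<open>b \<in> {1..n}\<close>] b by simp
  next
    case 2
    then have "A - {a} \<in> subsets_ge2 {1..n}" using A by (auto simp: subsets_ge2_def)
    then show ?thesis using zero less by blast
  qed (use zero less in auto)
qed

lemma phi_eq_0_imp_eq_0:
  assumes "A \<subseteq> {1..n}" "x \<in> H_space n A" "marginal n A (phi n x) = 0"
  shows "x = 0"
proof -
  obtain c :: real where c: "c \<noteq> 0"
    "\<And>x. x \<in> Lfun (words_on A) \<Longrightarrow> marginal n A (phi n x) = c *\<^sub>R x"
    using marginal_phi_eq_scaleR[OF assms(1)] by blast
  have "x \<in> Lfun (words_on A)" using assms(2) by (simp add: H_space_def)
  from c(2)[OF this] show "x = 0" using assms(3) c(1) by simp
qed

lemma dim_W_space: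
  assumes A: "A \<subseteq> {1..n}"
  shows "dim (W_space n A) = card (derangements (card A))"
proof -
  have fin: "finite (words_on A)" by (rule finite_words_on_subset[OF A])
  have "dim (phi n ` H_space n A) = dim (H_space n A)"
  proof (rule dim_injective_image[OF linear_phi subspace_H_space])
    show "finite (dirac ` words_on A)" using fin by simp
    show "H_space n A \<subseteq> span (dirac ` words_on A)"
      using Lfun_subset_span[OF fin] by (auto simp: H_space_def)
    show "x = 0" if "x \<in> H_space n A" "phi n x = 0" for x
      using phi_eq_0_imp_eq_0[OF A that(1)] that(2) linear_0[OF linear_marginal] by simp
  qed
  then show ?thesis by (simp add: W_space_def dim_H_space[OF A])
qed

theorem theorem2:
  fixes n :: nat
  assumes "2 \<le> n"
  shows "internal_direct_sum (insert None (Some ` subsets_ge2 {1..n}))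
           (\<lambda>i. case i of None \<Rightarrow> V0 n | Some A \<Rightarrow> W_space n A) (Lfun (perm_words n))
       \<and> (\<forall>A\<in>subsets_ge2 {1..n}. dim (W_space n A) = card (derangements (card A)))
       \<and> (\<forall>A\<in>subsets_ge2 {1..n}. phi n ` H_space n A = W_space n A)"
proof (intro conjI ballI)
  define I where "I = insert None (Some ` subsets_ge2 {1..n})"
  (* Constants are the component of the empty set, so that all indices are treated alike. *)
  define support where "support i = (case i of None \<Rightarrow> {} | Some A \<Rightarrow> A)" for i :: "nat set option"
  have support: "support i \<subseteq> {1..n}" if "i \<in> I" for i
    using that by (auto simp: I_def support_def subsets_ge2_def)
  have not_subset: "\<not> support i \<subseteq> support j"
    if "i \<in> I" "j \<in> I" "i \<noteq> j" "card (support j) \<le> card (support i)" for i j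
  proof
    assume "support i \<subseteq> support j"
    then have "support i = support j"
      using card_seteq[of "support j" "support i"] finite_subset[OF support[OF that(2)]] that(4)
      by simp
    then show False using that(1-3)
      by (auto simp: I_def support_def subsets_ge2_def split: option.splits)
  qed
  have "internal_direct_sum I (\<lambda>i. W_space n (support i)) (Lfun (perm_words n))"
  proof (rule internal_direct_sum_triangular[where M = "\<lambda>i. marginal n (support i)"
        and rank = "\<lambda>i. card (support i)"])
    show "finite I" by (simp add: I_def subsets_ge2_def)
    show "subspace (W_space n (support i))" for i
      unfolding W_space_def by (rule linear_subspace_image[OF linear_phi subspace_H_space])
    show "W_space n (support i) \<subseteq> Lfun (perm_words n)" for i
      unfolding W_space_def using phi_in_Lfun by blast
    show "marginal n (support j) x = 0"
      if "i \<in> I" "j \<in> I" "i \<noteq> j" "card (support j) \<le> card (support i)"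
        "x \<in> W_space n (support i)" for i j x
      using that(5) marginal_phi_eq_0[OF support[OF that(1)] not_subset[OF that(1-4)]]
      by (auto simp: W_space_def)
    show "x = 0" if "i \<in> I" "x \<in> W_space n (support i)" "marginal n (support i) x = 0" for i x
      using that phi_eq_0_imp_eq_0[OF support[OF that(1)]] linear_0[OF linear_phi]
      by (auto simp: W_space_def)
    show "\<exists>x\<in>W_space n (support i). marginal n (support i) f = marginal n (support i) x"
      if i: "i \<in> I" and f: "f \<in> Lfun (perm_words n)"
        and zero: "\<And>j. j \<in> I \<Longrightarrow> card (support j) < card (support i) \<Longrightarrow> marginal n (support j) f = 0"
      for i f
    proof -
      have "marginal n B f = 0"
        if "B = {} \<or> B \<in> subsets_ge2 {1..n}" "card B < card (support i)" for B
        using zero[of None] zero[of "Some B"] that by (auto simp: I_def support_def)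
      then have H: "marginal n (support i) f \<in> H_space n (support i)"
        using marginal_eq_0_of_smaller[OF support[OF i] f]
        by (intro marginal_in_H_space[OF support[OF i] f]) blast
      obtain c :: real where c: "c \<noteq> 0"
        "\<And>x. x \<in> Lfun (words_on (support i)) \<Longrightarrow> marginal n (support i) (phi n x) = c *\<^sub>R x"
        using marginal_phi_eq_scaleR[OF support[OF i]] by blast
      define y where "y = (1 / c) *\<^sub>R marginal n (support i) f"
      have y: "y \<in> H_space n (support i)"
        unfolding y_def by (rule subspace_scale[OF subspace_H_space H])
      then have "marginal n (support i) (phi n y) = marginal n (support i) f"
        using c by (simp add: H_space_def y_def)
      then show ?thesis
        using y unfolding W_space_def by (intro bexI[where x = "phi n y"] imageI) simp_all
    qed
    show "f = 0" if f: "f \<in> Lfun (perm_words n)"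
      and zero: "\<And>i. i \<in> I \<Longrightarrow> marginal n (support i) f = 0" for f
    proof -
      have "Some {1..n} \<in> I" using assms by (simp add: I_def subsets_ge2_def)
      from zero[OF this] show ?thesis using marginal_full[OF f] by (simp add: support_def)
    qed
  qed (auto simp: subspace_Lfun linear_marginal)
  moreover have "(\<lambda>i. W_space n (support i)) = (\<lambda>i. case i of None \<Rightarrow> V0 n | Some A \<Rightarrow> W_space n A)"
    by (auto simp: support_def V0_eq_W_space fun_eq_iff split: option.splits)
  ultimately show "internal_direct_sum (insert None (Some ` subsets_ge2 {1..n}))
      (\<lambda>i. case i of None \<Rightarrow> V0 n | Some A \<Rightarrow> W_space n A) (Lfun (perm_words n))"
    by (simp add: I_def)
next
  fix A assume "A \<in> subsets_ge2 {1..n}"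
  then show "dim (W_space n A) = card (derangements (card A))"
    by (intro dim_W_space) (simp add: subsets_ge2_def)
qed (simp add: W_space_def)

end
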